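(* Let $(X,d)$ be a complete metric space, and let $T:X\to\mathcal{CB}(X)$ be a non-expansive mapping such that for each $x\in X$ and for all $y\in Tx$ there exists $z\in Ty$ such that $$d(x,y)\leq \varphi(x,y)-\varphi(y,z),$$ where $\varphi:X\times X\to[0,\infty)$ is lower semicontinuous with respect to its first variable. Then $T$ has a fixed point.
   Context: $\mathcal{CB}(X)$ denotes the family of all nonempty closed and bounded subsets of $X$, and $\mathcal{H}$ is the Hausdorff metric on $\mathcal{CB}(X)$ induced by $d$: $\mathcal{H}(A,B)=\max\{\sup_{x\in B}d(x,A),\ \sup_{x\in A}d(x,B)\}$, where $d(x,A)=\inf_{a\in A}d(x,a)$. A mapping $T:X\to\mathcal{CB}(X)$ is non-expansive if $\mathcal{H}(Tx,Ty)\le d(x,y)$ for all $x,y\in X$. A fixed point of $T:X\to\mathcal{CB}(X)$ is a point $v\in X$ with $v\in Tv$. "Lower semicontinuous with respect to its first variable" means that for each fixed $y\in X$ the map $x\mapsto\varphi(x,y)$ is lower semicontinuous on $X$. *)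

theory Defs
  imports "HOL-Analysis.Analysis"
begin

definition CB :: "'a::metric_space set set" where
  "CB = {A. A \<noteq> {} \<and> closed A \<and> bounded A}"

(* The real-valued suprema are meaningful only for nonempty bounded sets: on CB both
   index sets are nonempty and the distances are bounded above. For nonempty A,
   infdist x A is the infimum of dist x a over a in A. *)
definition hausdorff_metric :: "'a::metric_space set \<Rightarrow> 'a set \<Rightarrow> real" where
  "hausdorff_metric A B = max (SUP x\<in>B. infdist x A) (SUP x\<in>A. infdist x B)"

definition nonexpansive :: "('a::metric_space \<Rightarrow> 'a set) \<Rightarrow> bool" where
  "nonexpansive T \<longleftrightarrow> (\<forall>x y. hausdorff_metric (T x) (T y) \<le> dist x y)"

definition lower_semicontinuous :: "('a::topological_space \<Rightarrow> real) \<Rightarrow> bool" where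
  "lower_semicontinuous f \<longleftrightarrow> (\<forall>x0. \<forall>c < f x0. \<forall>\<^sub>F x in nhds x0. c < f x)"

definition fixed_point :: "('a \<Rightarrow> 'a set) \<Rightarrow> 'a \<Rightarrow> bool" where
  "fixed_point T v \<longleftrightarrow> v \<in> T v"

end

theory Submission
  imports Defs
begin

text \<open>Choosing successive values of \<^term>\<open>T\<close> by the hypothesis on \<^term>\<open>\<phi>\<close> produces an orbit
  \<open>x\<^sub>n\<^sub>+\<^sub>1 \<in> T x\<^sub>n\<close> along which each step costs at most the drop of the potential \<open>\<phi> x\<^sub>n x\<^sub>n\<^sub>+\<^sub>1\<close>. The potential
  is nonnegative, so the total length of the orbit is finite and the orbit converges to some \<open>v\<close>
  (lemma \<open>Cauchy_if_dist_le_decrease\<close>). Nonexpansiveness puts \<open>x\<^sub>n\<^sub>+\<^sub>1\<close>, a point of \<open>T x\<^sub>n\<close>, within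
  \<open>dist x\<^sub>n v\<close> of \<open>T v\<close>; in the limit \<open>v\<close> is at distance \<open>0\<close> from the closed set \<open>T v\<close>
  (lemma \<open>limit_of_orbit_fixed\<close>).\<close>

lemma infdist_le_hausdorff_metric:
  assumes "A \<in> CB" "B \<in> CB" "x \<in> A"
  shows "infdist x B \<le> hausdorff_metric A B"
proof -
  from assms obtain b where b: "b \<in> B"
    by (auto simp: CB_def)
  from assms obtain e where e: "\<And>y. y \<in> A \<Longrightarrow> dist b y \<le> e"
    unfolding CB_def bounded_any_center[where a = b] by blast
  \<comment> \<open>A real supremum dominates its members only if they are bounded above, which is where the
    boundedness of \<^term>\<open>A\<close> enters.\<close>
  have "bdd_above ((\<lambda>y. infdist y B) ` A)"
  proof (rule bdd_aboveI2)
    fix y assume "y \<in> A"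
    then show "infdist y B \<le> e"
      using infdist_le[OF b, of y] e[of y] by (simp add: dist_commute)
  qed
  then have "infdist x B \<le> (SUP y\<in>A. infdist y B)"
    using \<open>x \<in> A\<close> by (rule cSUP_upper[rotated])
  then show ?thesis
    by (simp add: hausdorff_metric_def)
qed

text \<open>Telescoping gives \<open>dist (x m) (x n) \<le> f m - f n\<close> for \<open>m \<le> n\<close>, and the decreasing
  nonnegative sequence \<^term>\<open>f\<close> is itself Cauchy.\<close>
lemma Cauchy_if_dist_le_decrease:
  fixes x :: "nat \<Rightarrow> 'a::metric_space" and f :: "nat \<Rightarrow> real"
  assumes step: "\<And>n. dist (x n) (x (Suc n)) \<le> f n - f (Suc n)"
    and nonneg: "\<And>n. 0 \<le> f n"
  shows "Cauchy x"
proof -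
  have telescope: "dist (x m) (x n) \<le> f m - f n" if "m \<le> n" for m n
    using that
  proof (induction rule: dec_induct)
    case base
    then show ?case by simp
  next
    case (step k)
    then show ?case
      using dist_triangle[of "x m" "x (Suc k)" "x k"] assms(1)[of k] by linarith
  qed
  have "f (Suc n) \<le> f n" for n
    using step[of n] zero_le_dist[of "x n" "x (Suc n)"] by linarith
  then have "decseq f"
    by (rule decseq_SucI)
  then have "convergent f"
    using decseq_convergent[of f 0] nonneg by (metis convergent_def)
  then have "Cauchy f"
    by (rule convergent_Cauchy)
  show ?thesis
  proof (rule metric_CauchyI)
    fix e :: real assume "e > 0"
    then obtain M where M: "\<And>m n. m \<ge> M \<Longrightarrow> n \<ge> M \<Longrightarrow> dist (f m) (f n) < e"
      using \<open>Cauchy f\<close> unfolding Cauchy_def by blast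
    have "dist (x m) (x n) < e" if "m \<ge> M" "n \<ge> M" "m \<le> n" for m n
      using telescope[OF \<open>m \<le> n\<close>] M[OF that(1,2)] by (simp add: dist_real_def)
    then have "dist (x m) (x n) < e" if "m \<ge> M" "n \<ge> M" for m n
      using that by (metis dist_commute nle_le)
    then show "\<exists>M. \<forall>m\<ge>M. \<forall>n\<ge>M. dist (x m) (x n) < e"
      by blast
  qed
qed

text \<open>Both terms of \<open>infdist v (T v) \<le> dist v x\<^sub>n\<^sub>+\<^sub>1 + infdist x\<^sub>n\<^sub>+\<^sub>1 (T v)\<close> vanish in the limit: the
  second is at most \<open>dist x\<^sub>n v\<close> because \<open>x\<^sub>n\<^sub>+\<^sub>1\<close> belongs to \<open>T x\<^sub>n\<close>.\<close>
lemma limit_of_orbit_fixed: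
  fixes T :: "'a::metric_space \<Rightarrow> 'a set"
  assumes CB: "\<And>x. T x \<in> CB"
    and T: "nonexpansive T"
    and orbit: "\<And>n. x (Suc n) \<in> T (x n)"
    and lim: "x \<longlonglongrightarrow> v"
  shows "fixed_point T v"
proof -
  have bound: "infdist v (T v) \<le> dist v (x (Suc n)) + dist (x n) v" for n
  proof -
    have "infdist (x (Suc n)) (T v) \<le> hausdorff_metric (T (x n)) (T v)"
      by (rule infdist_le_hausdorff_metric[OF CB CB orbit])
    also have "\<dots> \<le> dist (x n) v"
      using T by (simp add: nonexpansive_def)
    finally show ?thesis
      using infdist_triangle[of v "T v" "x (Suc n)"] by linarith
  qed
  have "(\<lambda>n. dist v (x (Suc n)) + dist (x n) v) \<longlonglongrightarrow> dist v v + dist v v"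
    by (intro tendsto_intros lim LIMSEQ_Suc)
  then have "infdist v (T v) \<le> dist v v + dist v v"
    by (rule LIMSEQ_le_const) (use bound in blast)
  then have "infdist v (T v) = 0"
    using infdist_nonneg[of v "T v"] by simp
  then show ?thesis
    using CB[of v] by (simp add: fixed_point_def CB_def in_closed_iff_infdist_zero)
qed

theorem theorem2p1:
  fixes T :: "'a::complete_space \<Rightarrow> 'a set"
    and \<phi> :: "'a \<Rightarrow> 'a \<Rightarrow> real"
  assumes "\<And>x. T x \<in> CB"
    and "nonexpansive T"
    and "\<And>x y. 0 \<le> \<phi> x y"
    and "\<And>y. lower_semicontinuous (\<lambda>x. \<phi> x y)"
    and "\<And>x y. y \<in> T x \<Longrightarrow> \<exists>z\<in>T y. dist x y \<le> \<phi> x y - \<phi> y z"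
  shows "\<exists>v. fixed_point T v"
proof -
  obtain a b where ab: "b \<in> T a"
    using assms(1) by (fastforce simp: CB_def)
  \<comment> \<open>The choice of the next point depends on the last two, so the recursion runs on consecutive
    pairs \<open>(x\<^sub>n, x\<^sub>n\<^sub>+\<^sub>1)\<close>.\<close>
  have "\<exists>p. \<forall>n. snd (p n) \<in> T (fst (p n)) \<and>
      (fst (p (Suc n)) = snd (p n) \<and>
       dist (fst (p n)) (snd (p n)) \<le> \<phi> (fst (p n)) (snd (p n)) - \<phi> (snd (p n)) (snd (p (Suc n))))"
  proof (rule dependent_nat_choice)
    show "\<exists>p. snd p \<in> T (fst p)"
      using ab by (intro exI[of _ "(a, b)"]) simp
  next
    fix p :: "'a \<times> 'a" and n :: nat
    assume "snd p \<in> T (fst p)"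
    then obtain z where "z \<in> T (snd p)" "dist (fst p) (snd p) \<le> \<phi> (fst p) (snd p) - \<phi> (snd p) z"
      using assms(5) by blast
    then show "\<exists>q. snd q \<in> T (fst q) \<and> (fst q = snd p \<and>
        dist (fst p) (snd p) \<le> \<phi> (fst p) (snd p) - \<phi> (snd p) (snd q))"
      by (intro exI[of _ "(snd p, z)"]) simp
  qed
  then obtain p where p: "\<And>n. snd (p n) \<in> T (fst (p n))" "\<And>n. fst (p (Suc n)) = snd (p n)"
    "\<And>n. dist (fst (p n)) (snd (p n)) \<le> \<phi> (fst (p n)) (snd (p n)) - \<phi> (snd (p n)) (snd (p (Suc n)))"
    by blast
  define x where "x n = fst (p n)" for n
  have orbit: "x (Suc n) \<in> T (x n)" for n
    using p(1,2) by (simp add: x_def)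
  have step: "dist (x n) (x (Suc n)) \<le> \<phi> (x n) (x (Suc n)) - \<phi> (x (Suc n)) (x (Suc (Suc n)))" for n
    using p(3)[of n] by (simp add: x_def p(2))
  have "Cauchy x"
    by (rule Cauchy_if_dist_le_decrease[where f = "\<lambda>n. \<phi> (x n) (x (Suc n))"]) (use step assms(3) in auto)
  then obtain v where "x \<longlonglongrightarrow> v"
    using Cauchy_convergent convergent_def by blast
  then show ?thesis
    using limit_of_orbit_fixed[of T x v] assms(1,2) orbit by blast
qed

end
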